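(* Every abelian group $G$ has an invariant metric $d$ with $\mathrm{Isom}(G,d)=\Xi(G)$ taking at most $17$ values. Every Boolean group $G$ has an invariant metric $d$ with $\mathrm{Isom}(G,d)=\Xi(G)$ taking at most $5$ values. All these counts include the value zero.
   Context: Groups are abstract and of arbitrary cardinality. A metric $d$ on $G$ is (right-)invariant if $d(xg,yg)=d(x,y)$ for all $x,y,g\in G$. An isometry is a surjective distance-preserving map; $\mathrm{Isom}(G,d)$ is the group of isometries of $(G,d)$ onto itself. For $g\in G$ put $[g]=\{g,g^{-1}\}$, and $$\Xi(G)=\{F\in\mathrm{Sym}(G): [F(x)F(y)^{-1}]=[xy^{-1}]\text{ for all }x,y\in G\}.$$ A group is Boolean if every element has order at most two. Work in ZFC. *)

theory Defs
  imports
    "HOL-Analysis.Abstract_Metric_Spaces"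
    "HOL-Algebra.Bij"
    "HOL-Algebra.Multiplicative_Group"
begin

definition invariant_metric :: "('a, 'm) monoid_scheme \<Rightarrow> ('a \<Rightarrow> 'a \<Rightarrow> real) \<Rightarrow> bool" where
  "invariant_metric G d \<longleftrightarrow>
     Metric_space (carrier G) d \<and>
     (\<forall>x\<in>carrier G. \<forall>y\<in>carrier G. \<forall>g\<in>carrier G.
        d (x \<otimes>\<^bsub>G\<^esub> g) (y \<otimes>\<^bsub>G\<^esub> g) = d x y)"

text \<open>Self-maps of a carrier are represented, as in \<^const>\<open>Bij\<close>, by functions that are
  \<^const>\<open>undefined\<close> off the carrier, so that equality of sets of self-maps is the intended one.\<close>

definition Isom :: "'a set \<Rightarrow> ('a \<Rightarrow> 'a \<Rightarrow> real) \<Rightarrow> ('a \<Rightarrow> 'a) set" where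
  "Isom M d = {f \<in> extensional M. f ` M = M \<and> (\<forall>x\<in>M. \<forall>y\<in>M. d (f x) (f y) = d x y)}"

definition inv_class :: "('a, 'm) monoid_scheme \<Rightarrow> 'a \<Rightarrow> 'a set" where
  "inv_class G g = {g, inv\<^bsub>G\<^esub> g}"

definition Xi :: "('a, 'm) monoid_scheme \<Rightarrow> ('a \<Rightarrow> 'a) set" where
  "Xi G = {F \<in> Bij (carrier G). \<forall>x\<in>carrier G. \<forall>y\<in>carrier G.
     inv_class G (F x \<otimes>\<^bsub>G\<^esub> inv\<^bsub>G\<^esub> (F y)) = inv_class G (x \<otimes>\<^bsub>G\<^esub> inv\<^bsub>G\<^esub> y)}"

text \<open>The library sets the order of an element of infinite order to 0; hence the lower bound.\<close>

definition boolean_group :: "('a, 'm) monoid_scheme \<Rightarrow> bool" where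
  "boolean_group G \<longleftrightarrow>
     group G \<and> (\<forall>x\<in>carrier G. 1 \<le> group.ord G x \<and> group.ord G x \<le> 2)"

definition metric_values :: "'a set \<Rightarrow> ('a \<Rightarrow> 'a \<Rightarrow> real) \<Rightarrow> real set" where
  "metric_values M d = {d x y | x y. x \<in> M \<and> y \<in> M}"

end

theory Submission
  imports Defs
begin

text \<open>Well-order \<open>G\<close> with the involutions first, and let \<open>X\<close> consist of the elements that are
  not generated by their predecessors; it generates \<open>G\<close>. Split \<open>X\<close> into two classes alternating
  along the order and colour \<open>x\<^sup>\<plusminus>\<close> by the class of \<open>x \<in> X\<close>. Flag the elements \<open>y\<^sup>\<plusminus>x\<^sup>\<plusminus>\<close> with \<open>x < y\<close>,
  \<open>x\<close> in the first class and \<open>y\<close> in the second. These flags turn the two classes into a half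
  graph, which remembers the well-order and hence is rigid, so an isometry fixing \<open>1\<close> maps each
  \<open>x \<in> X\<close> to \<open>x\<close> or \<open>x\<^sup>-\<^sup>1\<close>. Since the translated isometries \<open>z \<mapsto> F(za) F(a)\<^sup>-\<^sup>1\<close> have the same
  property and distinct non-involutions of \<open>X\<close> never have equal or inverse squares, the sign at
  \<open>x\<close> is the same for every \<open>a\<close>. A second flag, on \<open>(ys)\<^sup>\<plusminus>\<^sup>1\<close> for the least non-involution \<open>s\<close> of \<open>X\<close>
  and \<open>y > s\<close>, distinguishes \<open>ys\<close> from \<open>y\<^sup>-\<^sup>1s\<close> and forces all signs to agree with that of \<open>s\<close>. So
  \<open>F\<close> is the identity or the inversion. All nonzero distances lie in \<open>[1, 2]\<close>, which makes the
  triangle inequality automatic.\<close>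

section \<open>Alternating two-colouring along a well-order\<close>

lemma wf_alternating_colouring:
  assumes "wf r" "trans r" "total r"
  obtains P :: "'a \<Rightarrow> bool" where
    "\<And>x y. x \<in> X \<Longrightarrow> y \<in> X \<Longrightarrow> (x, y) \<in> r \<Longrightarrow> P x = P y \<Longrightarrow>
       \<exists>z\<in>X. (x, z) \<in> r \<and> (z, y) \<in> r \<and> P z \<noteq> P x"
proof -
  \<comment> \<open>\<open>cov y x\<close> says that \<open>y\<close> is the immediate predecessor
    of \<open>x\<close> in \<open>X\<close>. The colour \<open>P\<close> flips from an element to
    its successor and restarts at \<open>False\<close> where no immediate predecessor
    exists.\<close>
  define cov where "cov y x \<longleftrightarrow> y \<in> X \<and> (y, x) \<in> r \<and> \<not> (\<exists>z\<in>X. (y, z) \<in> r \<and> (z, x) \<in> r)" for x y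
  define P where "P = wfrec r (\<lambda>f x. \<exists>y. cov y x \<and> \<not> f y)"
  have P: "P x \<longleftrightarrow> (\<exists>y. cov y x \<and> \<not> P y)" for x
    unfolding P_def by (subst wfrec[OF assms(1)]) (auto simp: cut_def cov_def)
  have cov_unique: "y = y'" if "cov y x" "cov y' x" for x y y'
    using that assms(3) unfolding cov_def total_on_def by blast
  show thesis
  proof
    fix x y assume xy: "x \<in> X" "y \<in> X" "(x, y) \<in> r" "P x = P y"
    then have "y \<in> {z \<in> X. (x, z) \<in> r}"
      by simp
    then obtain z where "z \<in> {z \<in> X. (x, z) \<in> r}" and
      "\<And>w. (w, z) \<in> r \<Longrightarrow> w \<notin> {z \<in> X. (x, z) \<in> r}"
      by (rule wfE_min[OF assms(1)]) blast
    then have z: "z \<in> X" "(x, z) \<in> r" and least: "\<And>w. (w, z) \<in> r \<Longrightarrow> \<not> (w \<in> X \<and> (x, w) \<in> r)"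
      by auto
    \<comment> \<open>\<open>z\<close> is the successor of \<open>x\<close> in \<open>X\<close>, so
      the two colours differ. As \<open>y\<close> has the colour of \<open>x\<close>, it is not
      \<open>z\<close> and must lie beyond it.\<close>
    have "cov x z"
      unfolding cov_def using xy z least by blast
    then have "P z \<noteq> P x"
      using P[of z] cov_unique by blast
    moreover from this have "(z, y) \<in> r"
      using xy least[of y] assms(3) by (metis UNIV_I total_on_def)
    ultimately show "\<exists>z\<in>X. (x, z) \<in> r \<and> (z, y) \<in> r \<and> P z \<noteq> P x"
      using z by blast
  qed
qed

section \<open>Inverse classes and quotients\<close>

lemma inv_class_self [simp]: "x \<in> inv_class G x"
  by (simp add: inv_class_def)

context group
begin

lemma inv_class_closed: "x \<in> carrier G \<Longrightarrow> g \<in> inv_class G x \<Longrightarrow> g \<in> carrier G"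
  by (auto simp: inv_class_def)

lemma inv_in_inv_class: "x \<in> carrier G \<Longrightarrow> g \<in> inv_class G x \<Longrightarrow> inv g \<in> inv_class G x"
  by (auto simp: inv_class_def)

lemma inv_class_eq: "x \<in> carrier G \<Longrightarrow> g \<in> inv_class G x \<Longrightarrow> inv_class G g = inv_class G x"
  by (auto simp: inv_class_def)

lemma inv_class_involution:
  assumes "x \<in> carrier G" "x \<otimes> x = \<one>"
  shows "inv_class G x = {x}"
  using assms inv_equality by (auto simp: inv_class_def)

lemma subgroup_inv_class:
  assumes "subgroup H G" "x \<in> carrier G" "g \<in> inv_class G x" "g \<in> H"
  shows "x \<in> H"
  using assms subgroup.m_inv_closed[OF assms(1,4)] by (auto simp: inv_class_def)

end

lemma (in group) mult_inv_cancel_right: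
  assumes "x \<in> carrier G" "y \<in> carrier G" "z \<in> carrier G"
  shows "(x \<otimes> inv z) \<otimes> inv (y \<otimes> inv z) = x \<otimes> inv y"
proof -
  have "inv z \<otimes> (z \<otimes> inv y) = inv y"
    using assms by (metis inv_closed inv_solve_left m_closed)
  then show ?thesis
    using assms by (simp add: inv_mult_group m_assoc)
qed

section \<open>Generators extracted from a well-order\<close>

locale ordered_comm_group = comm_group G for G (structure) +
  fixes r :: "'a rel"
  assumes wf_r: "wf r" and trans_r: "trans r" and total_r: "total r"
    and involutions_first: "\<lbrakk>x \<in> carrier G; y \<in> carrier G; x \<otimes> x = \<one>; y \<otimes> y \<noteq> \<one>\<rbrakk> \<Longrightarrow> (x, y) \<in> r"
begin

abbreviation less (infix \<open>\<prec>\<^sub>r\<close> 50) where "x \<prec>\<^sub>r y \<equiv> (x, y) \<in> r"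

lemma less_linear: "x \<prec>\<^sub>r y \<or> x = y \<or> y \<prec>\<^sub>r x"
  using total_r by (auto simp: total_on_def)

lemma less_trans: "x \<prec>\<^sub>r y \<Longrightarrow> y \<prec>\<^sub>r z \<Longrightarrow> x \<prec>\<^sub>r z"
  using trans_r by (rule transD)

lemma less_asym: "x \<prec>\<^sub>r y \<Longrightarrow> \<not> y \<prec>\<^sub>r x"
  using wf_r by (rule wf_not_sym)

definition lower :: "'a \<Rightarrow> 'a set" where
  "lower x = generate G {y \<in> carrier G. y \<prec>\<^sub>r x}"

definition gens :: "'a set" where
  "gens = {x \<in> carrier G. x \<notin> lower x}"

lemma gens_closed: "x \<in> gens \<Longrightarrow> x \<in> carrier G"
  by (simp add: gens_def)

lemma subgroup_lower: "subgroup (lower x) G"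
  unfolding lower_def by (rule generate_is_subgroup) auto

lemma lower_memI: "y \<in> carrier G \<Longrightarrow> y \<prec>\<^sub>r x \<Longrightarrow> g \<in> inv_class G y \<Longrightarrow> g \<in> lower x"
  by (auto simp: lower_def inv_class_def intro: generate.incl generate.inv)

lemma one_notin_gens: "\<one> \<notin> gens"
  using subgroup.one_closed[OF subgroup_lower] by (auto simp: gens_def)

lemma inv_class_gens_notin_lower: "x \<in> gens \<Longrightarrow> g \<in> inv_class G x \<Longrightarrow> g \<notin> lower x"
  using subgroup_inv_class[OF subgroup_lower] by (auto simp: gens_def)

text \<open>Induction along \<open>r\<close>: if all predecessors of \<open>x\<close> lie in the
  generated subgroup, so does \<open>lower x\<close>, and \<open>x\<close> is either in
  \<open>lower x\<close> or itself a generator.\<close>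

lemma generate_gens: "generate G gens = carrier G"
proof (intro equalityI subsetI)
  fix x assume "x \<in> generate G gens"
  then show "x \<in> carrier G"
    using generate_in_carrier[of gens] gens_closed by blast
next
  fix x
  show "x \<in> carrier G \<Longrightarrow> x \<in> generate G gens"
  proof (induction x rule: wf_induct_rule[OF wf_r])
    case (1 x)
    have "lower x \<subseteq> generate G gens"
      unfolding lower_def
      by (intro generate_subgroup_incl generate_is_subgroup) (use 1 gens_closed in auto)
    then show ?case
      using 1 by (cases "x \<in> gens") (auto simp: gens_def intro: generate.incl)
  qed
qed

lemma inv_class_gens_unique:
  assumes "x \<in> gens" "y \<in> gens" "g \<in> inv_class G x" "g \<in> inv_class G y"
  shows "x = y"
  using less_linear[of x y] lower_memI inv_class_gens_notin_lower gens_closed assms by blast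

text \<open>If \<open>y\<close> preceded \<open>y'\<close>, then \<open>k\<close>, \<open>h\<close>
  and \<open>x'\<close> would all lie in the subgroup \<open>lower y'\<close>, hence so would
  \<open>k'\<close>. Letting \<open>x'\<close> range over \<open>lower y'\<close> covers
  \<open>\<one>\<close> as well as smaller generators and their inverses.\<close>

lemma product_top_unique:
  assumes "x \<in> carrier G" "y \<in> gens" "x \<prec>\<^sub>r y" "x' \<in> lower y'" "y' \<in> gens"
    and "h \<in> inv_class G x" "k \<in> inv_class G y" "k' \<in> inv_class G y'"
    and "k \<otimes> h = k' \<otimes> x'"
  shows "\<not> y \<prec>\<^sub>r y'"
proof
  assume "y \<prec>\<^sub>r y'"
  then have "k \<in> lower y'" "h \<in> lower y'"
    using assms less_trans lower_memI gens_closed by blast+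
  moreover have "k' = k \<otimes> h \<otimes> inv x'"
    using assms inv_class_closed gens_closed subgroup.mem_carrier[OF subgroup_lower]
    by (metis inv_solve_right m_closed)
  ultimately have "k' \<in> lower y'"
    using subgroup_lower \<open>x' \<in> lower y'\<close> by (metis subgroup.m_closed subgroup.m_inv_closed)
  then show False
    using assms inv_class_gens_notin_lower by blast
qed

lemma product_top_eq:
  assumes "x \<in> gens" "y \<in> gens" "x \<prec>\<^sub>r y" "x' \<in> gens" "y' \<in> gens" "x' \<prec>\<^sub>r y'"
    and "h \<in> inv_class G x" "k \<in> inv_class G y" "h' \<in> inv_class G x'" "k' \<in> inv_class G y'"
    and "k \<otimes> h = k' \<otimes> h'"
  shows "y = y'"
proof -
  have "\<not> y \<prec>\<^sub>r y'"
    using assms by (intro product_top_unique[of x y h' y' h k k'])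
      (auto intro: lower_memI gens_closed)
  moreover have "\<not> y' \<prec>\<^sub>r y"
    using assms by (intro product_top_unique[of x' y' h y h' k' k])
      (auto intro: lower_memI gens_closed)
  ultimately show ?thesis
    using less_linear by blast
qed

text \<open>If \<open>x\<^sup>2 = g\<^sup>2\<close>, then \<open>xg\<^sup>-\<^sup>1\<close> is an involution and so precedes \<open>x\<close>: this is why the
  involutions come first.\<close>

lemma square_neq_aux:
  assumes "x \<in> gens" "y \<in> carrier G" "y \<prec>\<^sub>r x" "x \<otimes> x \<noteq> \<one>" "g \<in> inv_class G y"
  shows "x \<otimes> x \<noteq> g \<otimes> g"
proof
  assume eq: "x \<otimes> x = g \<otimes> g"
  have cl: "x \<in> carrier G" "g \<in> carrier G"
    using assms gens_closed inv_class_closed by auto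
  let ?e = "x \<otimes> inv g"
  have "?e \<otimes> ?e = (x \<otimes> x) \<otimes> inv (g \<otimes> g)"
    using cl by (simp add: inv_mult m_ac)
  then have "?e \<otimes> ?e = \<one>"
    using eq cl by simp
  then have "?e \<in> lower x"
    using cl assms involutions_first by (intro lower_memI[of ?e]) auto
  moreover have "g \<in> lower x"
    using assms lower_memI by blast
  ultimately have "?e \<otimes> g \<in> lower x"
    by (rule subgroup.m_closed[OF subgroup_lower])
  moreover have "?e \<otimes> g = x"
    using cl by (simp add: m_assoc)
  ultimately show False
    using assms by (simp add: gens_def)
qed

text \<open>If \<open>y\<close> is the later generator, its square is that of \<open>x\<close> or of
  \<open>inv x\<close>, so \<open>y\<close> is no involution either and
  \<open>square_neq_aux\<close> applies with the roles exchanged.\<close>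

lemma square_neq:
  assumes "x \<in> gens" "y \<in> gens" "x \<noteq> y" "x \<otimes> x \<noteq> \<one>" "g \<in> inv_class G y"
  shows "x \<otimes> x \<noteq> g \<otimes> g"
proof (cases "y \<prec>\<^sub>r x")
  case True
  then show ?thesis
    using assms square_neq_aux gens_closed by blast
next
  case False
  then have "x \<prec>\<^sub>r y"
    using less_linear assms by blast
  have cl: "x \<in> carrier G" "y \<in> carrier G"
    using assms gens_closed by auto
  show ?thesis
  proof
    assume eq: "x \<otimes> x = g \<otimes> g"
    then have "y \<otimes> y = x \<otimes> x \<or> y \<otimes> y = inv x \<otimes> inv x"
      using assms(5) cl
      by (auto simp: inv_class_def) (metis inv_inv inv_mult m_closed)
    moreover from this have "y \<otimes> y \<noteq> \<one>"
      using assms(4) cl by (metis inv_eq_1_iff inv_mult m_closed)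
    ultimately show False
      using square_neq_aux[OF assms(2) cl(1) \<open>x \<prec>\<^sub>r y\<close>, of x]
        square_neq_aux[OF assms(2) cl(1) \<open>x \<prec>\<^sub>r y\<close>, of "inv x"] by (auto simp: inv_class_def)
  qed
qed

end

section \<open>Colours of group elements and the half graph\<close>

locale coloured_comm_group = ordered_comm_group +
  fixes par :: "'a \<Rightarrow> bool"
  assumes par_between: "\<lbrakk>x \<in> gens; y \<in> gens; x \<prec>\<^sub>r y; par x = par y\<rbrakk> \<Longrightarrow>
    \<exists>z\<in>gens. x \<prec>\<^sub>r z \<and> z \<prec>\<^sub>r y \<and> par z \<noteq> par x"
begin

definition node :: "bool \<Rightarrow> 'a \<Rightarrow> bool" where
  "node p g \<longleftrightarrow> (\<exists>x\<in>gens. par x = p \<and> g \<in> inv_class G x)"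

definition edge :: "'a \<Rightarrow> bool" where
  "edge g \<longleftrightarrow> (\<exists>x\<in>gens. \<exists>y\<in>gens. x \<prec>\<^sub>r y \<and> \<not> par x \<and> par y \<and>
     (\<exists>h\<in>inv_class G x. \<exists>k\<in>inv_class G y. g = k \<otimes> h))"

definition lead :: "'a \<Rightarrow> bool" where
  "lead s \<longleftrightarrow> s \<in> gens \<and> s \<otimes> s \<noteq> \<one> \<and> (\<forall>x\<in>gens. x \<otimes> x \<noteq> \<one> \<longrightarrow> \<not> x \<prec>\<^sub>r s)"

definition mark :: "'a \<Rightarrow> bool" where
  "mark g \<longleftrightarrow> (\<exists>s y. lead s \<and> y \<in> gens \<and> s \<prec>\<^sub>r y \<and> g \<in> inv_class G (y \<otimes> s))"

text \<open>The first flag singles out distance zero; the other four leave at most 16 colours for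
  the remaining elements.\<close>

definition colour :: "'a \<Rightarrow> bool \<times> bool \<times> bool \<times> bool \<times> bool" where
  "colour g = (g = \<one>, node False g, node True g, edge g, mark g)"

lemma node_closed: "node p g \<Longrightarrow> g \<in> carrier G"
  using inv_class_closed gens_closed by (auto simp: node_def)

lemma node_unique: "node p g \<Longrightarrow> node q g \<Longrightarrow> p = q"
  using inv_class_gens_unique by (auto simp: node_def)

lemma colour_eqD:
  assumes "colour g = colour h"
  shows "g = \<one> \<longleftrightarrow> h = \<one>" "node p g = node p h" "edge g = edge h" "mark g = mark h"
  using assms by (cases p; simp add: colour_def)+

lemma node_inv:
  assumes "node p g"
  shows "node p (inv g)"
  using assms inv_in_inv_class gens_closed unfolding node_def by blast

lemma edge_inv:
  assumes "edge g"
  shows "edge (inv g)"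
proof -
  obtain x y h k where *: "x \<in> gens" "y \<in> gens" "x \<prec>\<^sub>r y" "\<not> par x" "par y"
    "h \<in> inv_class G x" "k \<in> inv_class G y" "g = k \<otimes> h"
    using assms unfolding edge_def by blast
  moreover from this have "h \<in> carrier G" "k \<in> carrier G"
    using inv_class_closed gens_closed by blast+
  ultimately have "inv g = inv k \<otimes> inv h"
    by (simp add: inv_mult)
  then show ?thesis
    using * inv_in_inv_class gens_closed unfolding edge_def by blast
qed

lemma mark_inv:
  assumes "mark g"
  shows "mark (inv g)"
  using assms inv_in_inv_class gens_closed m_closed unfolding mark_def lead_def by blast

lemma colour_inv:
  assumes "g \<in> carrier G"
  shows "colour (inv g) = colour g"
proof -
  have "node p (inv g) = node p g" "edge (inv g) = edge g" "mark (inv g) = mark g" for p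
    using node_inv edge_inv mark_inv inv_inv[OF assms] by metis+
  then show ?thesis
    using assms by (simp add: colour_def)
qed

text \<open>Meaningful only on nodes, by \<open>inv_class_gens_unique\<close>; it carries the order
  of the generators over to the nodes.\<close>

definition base :: "'a \<Rightarrow> 'a" where
  "base g = (THE x. x \<in> gens \<and> g \<in> inv_class G x)"

lemma base_eqI: "x \<in> gens \<Longrightarrow> g \<in> inv_class G x \<Longrightarrow> base g = x"
  unfolding base_def by (rule the_equality) (use inv_class_gens_unique in auto)

lemma node_base:
  assumes "node p g"
  shows "base g \<in> gens" "g \<in> inv_class G (base g)" "par (base g) = p"
  using assms base_eqI unfolding node_def by auto

lemma node_gens: "x \<in> gens \<Longrightarrow> node (par x) x"
  unfolding node_def by auto

lemma base_gens: "x \<in> gens \<Longrightarrow> base x = x"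
  by (rule base_eqI) auto

text \<open>The half graph between the two classes. If \<open>base h\<close> preceded
  \<open>base g\<close>, then \<open>base g\<close> would be the larger generator in the flagged
  product; but \<open>edge\<close> gives that one the colour \<open>True\<close>, and
  \<open>base g\<close> has the colour \<open>False\<close>.\<close>

lemma edge_iff:
  assumes g: "node False g" and h: "node True h"
  shows "edge (g \<otimes> inv h) \<longleftrightarrow> base g \<prec>\<^sub>r base h"
proof
  assume "base g \<prec>\<^sub>r base h"
  moreover have "inv h \<in> inv_class G (base h)"
    using node_base[OF h] inv_in_inv_class gens_closed by blast
  moreover have "g \<otimes> inv h = inv h \<otimes> g"
    using node_closed[OF g] node_closed[OF h] by (simp add: m_comm)
  ultimately show "edge (g \<otimes> inv h)"
    using node_base[OF g] node_base[OF h] unfolding edge_def by blast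
next
  assume "edge (g \<otimes> inv h)"
  then obtain x y h' k' where *: "x \<in> gens" "y \<in> gens" "x \<prec>\<^sub>r y" "par y"
    "h' \<in> inv_class G x" "k' \<in> inv_class G y" "g \<otimes> inv h = k' \<otimes> h'"
    unfolding edge_def by blast
  have inv_h: "inv h \<in> inv_class G (base h)"
    using node_base[OF h] inv_in_inv_class gens_closed by blast
  have False if "base h \<prec>\<^sub>r base g"
    using product_top_eq[OF node_base(1)[OF h] node_base(1)[OF g] that *(1,2,3) inv_h
        node_base(2)[OF g] *(5,6,7)] node_base(3)[OF g] \<open>par y\<close> by simp
  moreover have "base g \<noteq> base h"
    using node_base[OF g] node_base[OF h] by auto
  ultimately show "base g \<prec>\<^sub>r base h"
    using less_linear by blast
qed

section \<open>Isometries fixing the identity, and their translates\<close>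

definition pointed_isom :: "('a \<Rightarrow> 'a) \<Rightarrow> bool" where
  "pointed_isom F \<longleftrightarrow> F ` carrier G = carrier G \<and> F \<one> = \<one> \<and>
     (\<forall>x\<in>carrier G. \<forall>y\<in>carrier G. colour (F x \<otimes> inv (F y)) = colour (x \<otimes> inv y))"

lemma pointed_isomD:
  assumes "pointed_isom F"
  shows "F ` carrier G = carrier G" "F \<one> = \<one>" "x \<in> carrier G \<Longrightarrow> F x \<in> carrier G"
    "x \<in> carrier G \<Longrightarrow> y \<in> carrier G \<Longrightarrow> colour (F x \<otimes> inv (F y)) = colour (x \<otimes> inv y)"
  using assms unfolding pointed_isom_def by auto

lemma pointed_isom_colour:
  assumes "pointed_isom F" "x \<in> carrier G"
  shows "colour (F x) = colour x"
  using pointed_isomD(4)[OF assms(1), of x \<one>] pointed_isomD(2,3)[OF assms(1)] assms by simp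

lemma pointed_isom_inj:
  assumes "pointed_isom F"
  shows "inj_on F (carrier G)"
proof (rule inj_onI)
  fix x y assume *: "x \<in> carrier G" "y \<in> carrier G" "F x = F y"
  have "colour (x \<otimes> inv y) = colour \<one>"
    using * pointed_isomD(3,4)[OF assms] by (metis r_inv)
  then have "x \<otimes> inv y = \<one>"
    using colour_eqD(1) by blast
  then show "x = y"
    using * by (metis inv_equality inv_inv inv_closed)
qed

lemma pointed_isom_inv_into:
  assumes "pointed_isom F"
  shows "pointed_isom (inv_into (carrier G) F)" (is "pointed_isom ?F'")
proof -
  have bij: "bij_betw F (carrier G) (carrier G)"
    using pointed_isom_inj[OF assms] pointed_isomD(1)[OF assms] by (simp add: bij_betw_def)
  have F': "?F' x \<in> carrier G" "F (?F' x) = x" if "x \<in> carrier G" for x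
    using that pointed_isomD(1)[OF assms] by (auto intro: inv_into_into f_inv_into_f)
  have "?F' ` carrier G = carrier G"
    using bij_betw_inv_into[OF bij] by (simp add: bij_betw_def)
  moreover have "?F' \<one> = \<one>"
    using inv_into_f_f[OF pointed_isom_inj[OF assms], of \<one>] pointed_isomD(2)[OF assms] by simp
  ultimately show ?thesis
    unfolding pointed_isom_def using F' pointed_isomD(4)[OF assms] by metis
qed

definition shift :: "('a \<Rightarrow> 'a) \<Rightarrow> 'a \<Rightarrow> 'a \<Rightarrow> 'a" where
  "shift F a z = F (z \<otimes> a) \<otimes> inv (F a)"

text \<open>\<open>F\<close> need not fix \<open>\<one>\<close>, so an arbitrary isometry can be
  turned into a pointed one. Right translations cancel in quotients, and dividing by
  \<open>F a\<close> moves the image of \<open>\<one>\<close> back to \<open>\<one>\<close>.\<close>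

lemma pointed_isom_shiftI:
  assumes "\<And>x y. x \<in> carrier G \<Longrightarrow> y \<in> carrier G \<Longrightarrow> colour (F x \<otimes> inv (F y)) = colour (x \<otimes> inv y)"
    and "F ` carrier G = carrier G" and a: "a \<in> carrier G"
  shows "pointed_isom (shift F a)"
  unfolding pointed_isom_def shift_def
proof (intro conjI ballI)
  have F: "F x \<in> carrier G" if "x \<in> carrier G" for x
    using assms(2) that by auto
  show "F (\<one> \<otimes> a) \<otimes> inv (F a) = \<one>"
    using a F by simp
  show "(\<lambda>z. F (z \<otimes> a) \<otimes> inv (F a)) ` carrier G = carrier G"
  proof (intro equalityI subsetI)
    fix w assume w: "w \<in> carrier G"
    then obtain v where v: "v \<in> carrier G" "w \<otimes> F a = F v"
      using F[OF a] assms(2) by (metis imageE m_closed)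
    have "v \<otimes> inv a \<otimes> a = v"
      using a v(1) by (simp add: m_assoc)
    then have "w = F (v \<otimes> inv a \<otimes> a) \<otimes> inv (F a)"
      using inv_solve_right[of w "F v" "F a"] w F v a by simp
    then show "w \<in> (\<lambda>z. F (z \<otimes> a) \<otimes> inv (F a)) ` carrier G"
      using a v(1) by (intro image_eqI[of _ _ "v \<otimes> inv a"] m_closed inv_closed)
  next
    fix w assume "w \<in> (\<lambda>z. F (z \<otimes> a) \<otimes> inv (F a)) ` carrier G"
    then show "w \<in> carrier G"
      using a by (auto intro!: F m_closed inv_closed)
  qed
  fix x y assume *: "x \<in> carrier G" "y \<in> carrier G"
  have "F (x \<otimes> a) \<otimes> inv (F a) \<otimes> inv (F (y \<otimes> a) \<otimes> inv (F a))
      = F (x \<otimes> a) \<otimes> inv (F (y \<otimes> a))"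
    using * a by (intro mult_inv_cancel_right F m_closed inv_closed)
  then have "colour (F (x \<otimes> a) \<otimes> inv (F a) \<otimes> inv (F (y \<otimes> a) \<otimes> inv (F a)))
      = colour (F (x \<otimes> a) \<otimes> inv (F (y \<otimes> a)))"
    by (rule arg_cong)
  also have "\<dots> = colour (x \<otimes> a \<otimes> inv (y \<otimes> a))"
    using * a by (intro assms(1) m_closed)
  also have "x \<otimes> a \<otimes> inv (y \<otimes> a) = x \<otimes> inv y"
    using mult_inv_cancel_right[of x y "inv a"] * a by simp
  finally show "colour (F (x \<otimes> a) \<otimes> inv (F a) \<otimes> inv (F (y \<otimes> a) \<otimes> inv (F a)))
      = colour (x \<otimes> inv y)" .
qed

text \<open>Commutativity turns a quotient of inverses into the inverse of a quotient, which has the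
  same colour. This reduces the case of an inverted generator to that of a fixed one.\<close>

lemma pointed_isom_inverse:
  assumes "pointed_isom F"
  shows "pointed_isom (\<lambda>z. inv (F z))"
  unfolding pointed_isom_def
proof (intro conjI ballI)
  show "(\<lambda>z. inv (F z)) ` carrier G = carrier G"
  proof (intro equalityI subsetI)
    fix w assume w: "w \<in> carrier G"
    then obtain v where "v \<in> carrier G" "inv w = F v"
      using pointed_isomD(1)[OF assms] inv_closed by blast
    then show "w \<in> (\<lambda>z. inv (F z)) ` carrier G"
      using w by (metis image_eqI inv_inv)
  qed (use pointed_isomD(3)[OF assms] in auto)
  show "inv (F \<one>) = \<one>"
    using pointed_isomD(2)[OF assms] by simp
  fix x y assume *: "x \<in> carrier G" "y \<in> carrier G"
  then have F: "F x \<in> carrier G" "F y \<in> carrier G"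
    using pointed_isomD(3)[OF assms] by auto
  then have "inv (F x) \<otimes> inv (inv (F y)) = inv (F x \<otimes> inv (F y))"
    by (simp add: inv_mult)
  then show "colour (inv (F x) \<otimes> inv (inv (F y))) = colour (x \<otimes> inv y)"
    using * F pointed_isomD(4)[OF assms] by (simp only: colour_inv m_closed inv_closed)
qed

section \<open>Rigidity: generators are fixed up to inversion\<close>

lemma pointed_isom_node:
  assumes "pointed_isom F" "node p g"
  shows "node p (F g)"
  using colour_eqD(2)[OF pointed_isom_colour[OF assms(1)]] assms(2) node_closed by blast

lemma pointed_isom_edge:
  assumes "pointed_isom F" "node False g" "node True h"
  shows "base (F g) \<prec>\<^sub>r base (F h) \<longleftrightarrow> base g \<prec>\<^sub>r base h"
proof -
  have "edge (F g \<otimes> inv (F h)) = edge (g \<otimes> inv h)"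
    using pointed_isomD(4)[OF assms(1)] assms node_closed by (intro colour_eqD(3)) blast
  then show ?thesis
    using assms edge_iff pointed_isom_node by metis
qed

text \<open>Edges compare only nodes of different classes. A generator \<open>z\<close> of the other
  class between the two bases links them: \<open>F\<close> preserves the comparisons of both nodes
  with \<open>z\<close>.\<close>

lemma pointed_isom_mono:
  assumes F: "pointed_isom F" and g: "node p g" and h: "node p h" and "base g \<prec>\<^sub>r base h"
  shows "base (F g) \<prec>\<^sub>r base (F h)"
proof -
  obtain z where z: "z \<in> gens" "base g \<prec>\<^sub>r z" "z \<prec>\<^sub>r base h" "par z \<noteq> p"
    using par_between[of "base g" "base h"] node_base[OF g] node_base[OF h] assms(4) by auto
  then have node_z: "node (\<not> p) z" and base_z: "base z = z"
    using node_gens[of z] base_gens by auto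
  show ?thesis
  proof (cases p)
    case True
    then have "base (F z) \<prec>\<^sub>r base (F h)" "\<not> base (F z) \<prec>\<^sub>r base (F g)"
      using pointed_isom_edge[OF F, of z] g h node_z z less_asym by (auto simp: base_z)
    then show ?thesis
      using less_linear less_trans by metis
  next
    case False
    then have "base (F g) \<prec>\<^sub>r base (F z)" "\<not> base (F h) \<prec>\<^sub>r base (F z)"
      using pointed_isom_edge[OF F, of _ z] g h node_z z less_asym by (auto simp: base_z)
    then show ?thesis
      using less_linear less_trans by metis
  qed
qed

text \<open>A strictly increasing self-map of a well-order moves nothing down: at a least
  counterexample \<open>g\<close>, monotonicity makes \<open>F g\<close> a smaller
  counterexample.\<close>

lemma pointed_isom_ge:
  assumes "pointed_isom F"
  shows "node p g \<Longrightarrow> \<not> base (F g) \<prec>\<^sub>r base g"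
proof (induction "base g" arbitrary: g rule: wf_induct_rule[OF wf_r])
  case 1
  show ?case
  proof
    assume less: "base (F g) \<prec>\<^sub>r base g"
    have "node p (F g)"
      using pointed_isom_node assms 1 by blast
    then show False
      using 1 less pointed_isom_mono[OF assms] by blast
  qed
qed

text \<open>Neither \<open>F\<close> nor its inverse map moves a base down, so the base stays where
  it is.\<close>

lemma pointed_isom_gens:
  assumes F: "pointed_isom F" and x: "x \<in> gens"
  shows "F x \<in> inv_class G x"
proof -
  have node: "node (par x) x" "node (par x) (F x)"
    using node_gens[OF x] pointed_isom_node[OF F] by auto
  have "inv_into (carrier G) F (F x) = x"
    using inv_into_f_f[OF pointed_isom_inj[OF F]] gens_closed[OF x] by simp
  then have "\<not> base x \<prec>\<^sub>r base (F x)"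
    using pointed_isom_ge[OF pointed_isom_inv_into[OF F] node(2)] by simp
  then have "base (F x) = base x"
    using pointed_isom_ge[OF F node(1)] less_linear by blast
  then show ?thesis
    using node_base(2)[OF node(2)] base_gens[OF x] by simp
qed

section \<open>The sign at a generator is the same in all translates\<close>

lemma pointed_isom_shift:
  assumes "pointed_isom F" "a \<in> carrier G"
  shows "pointed_isom (shift F a)"
  using assms pointed_isomD by (intro pointed_isom_shiftI) blast+

lemma shift_shift:
  assumes "pointed_isom F" "a \<in> carrier G" "b \<in> carrier G" "z \<in> carrier G"
  shows "shift (shift F a) b z = shift F (b \<otimes> a) z"
proof -
  have "F (z \<otimes> (b \<otimes> a)) \<in> carrier G" "F (b \<otimes> a) \<in> carrier G" "F a \<in> carrier G"
    using assms pointed_isomD(3)[OF assms(1)] by auto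
  then show ?thesis
    using assms(2-4) mult_inv_cancel_right by (simp add: shift_def m_assoc[of z b a])
qed

lemma shift_one:
  assumes "pointed_isom F" "z \<in> carrier G"
  shows "shift F \<one> z = F z"
  using assms pointed_isomD(2,3)[OF assms(1)] by (simp add: shift_def)

lemma shift_mult:
  assumes "pointed_isom F" "a \<in> carrier G" "z \<in> carrier G"
  shows "F (z \<otimes> a) = shift F a z \<otimes> F a"
  using assms pointed_isomD(3)[OF assms(1)] by (simp add: shift_def m_assoc)

lemma shift_inverse:
  assumes "pointed_isom F" "a \<in> carrier G" "z \<in> carrier G"
  shows "shift (\<lambda>z. inv (F z)) a z = inv (shift F a z)"
  using assms pointed_isomD(3)[OF assms(1)] by (simp add: shift_def inv_mult)

text \<open>Otherwise the translate at \<open>k\<close> inverts \<open>x\<close>, and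
  \<open>x\<close> is no involution. For \<open>k = x\<close> this contradicts injectivity; for
  \<open>k \<noteq> x\<close>, computing \<open>F (x \<otimes> k)\<close> in two ways contradicts
  \<open>square_neq\<close>.\<close>

lemma fixed_shift_gens:
  assumes F: "pointed_isom F" and x: "x \<in> gens" and k: "k \<in> gens" and Fx: "F x = x"
  shows "shift F k x = x"
proof (rule ccontr)
  assume neq: "shift F k x \<noteq> x"
  have cl: "x \<in> carrier G" "k \<in> carrier G"
    using x k gens_closed by auto
  have shifts: "pointed_isom (shift F k)" "pointed_isom (shift F x)"
    using F cl pointed_isom_shift by auto
  have inv_x: "shift F k x = inv x"
    using pointed_isom_gens[OF shifts(1) x] neq by (simp add: inv_class_def)
  have nontriv: "x \<otimes> x \<noteq> \<one>"
    using inv_x neq cl inv_equality by metis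
  show False
  proof (cases "k = x")
    case True
    \<comment> \<open>The translate at \<open>x\<close> would send both \<open>x\<close> and
      \<open>inv x\<close> to \<open>inv x\<close>.\<close>
    have "shift F x (inv x) = inv x"
      using cl Fx pointed_isomD(2)[OF F] by (simp add: shift_def)
    then have "inv x = x"
      using inv_x True inj_onD[OF pointed_isom_inj[OF shifts(2)], of x "inv x"] cl by simp
    then show False
      using inv_x neq by simp
  next
    case False
    define u v where "u = F k" and "v = shift F x k"
    have u: "u \<in> inv_class G k" and v: "v \<in> inv_class G k"
      using pointed_isom_gens F shifts k by (auto simp: u_def v_def)
    have cl': "u \<in> carrier G" "v \<in> carrier G"
      using u v cl inv_class_closed by auto
    \<comment> \<open>\<open>x \<otimes> k\<close> is reached from \<open>k\<close> by a step
      \<open>x\<close> and from \<open>x\<close> by a step \<open>k\<close>. Equating the two images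
      expresses \<open>x \<otimes> x\<close> as \<open>u \<otimes> inv v\<close>.\<close>
    have "inv x \<otimes> u = F (x \<otimes> k)"
      using shift_mult[OF F, of k x] inv_x cl by (simp add: u_def)
    also have "x \<otimes> k = k \<otimes> x"
      using cl by (rule m_comm)
    also have "F (k \<otimes> x) = v \<otimes> x"
      using shift_mult[OF F, of x k] Fx cl by (simp add: v_def)
    finally have "u = x \<otimes> (v \<otimes> x)"
      using cl cl' by (metis inv_solve_left m_closed)
    also have "\<dots> = (x \<otimes> x) \<otimes> v"
      using cl cl' by (simp add: m_ac)
    finally have sq: "x \<otimes> x = u \<otimes> inv v"
      using cl cl' by (metis inv_solve_right m_closed)
    have "u \<otimes> inv v \<in> {\<one>, k \<otimes> k, inv k \<otimes> inv k}"
      using u v cl by (auto simp: inv_class_def)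
    then show False
      using sq nontriv square_neq[OF x k _ nontriv, of k] square_neq[OF x k _ nontriv, of "inv k"] False
      by (auto simp: inv_class_def)
  qed
qed

lemma flipped_shift_gens:
  assumes F: "pointed_isom F" and x: "x \<in> gens" and k: "k \<in> gens" and Fx: "F x = inv x"
  shows "shift F k x = inv x"
proof -
  have cl: "x \<in> carrier G" "k \<in> carrier G"
    using x k gens_closed by auto
  have "inv (shift F k x) = x"
    using fixed_shift_gens[OF pointed_isom_inverse[OF F] x k] Fx cl shift_inverse[OF F] by simp
  moreover have "shift F k x \<in> carrier G"
    using pointed_isomD(3)[OF pointed_isom_shift[OF F]] cl by blast
  ultimately show ?thesis
    using inv_inv by metis
qed

text \<open>Translating by \<open>k\<close> again recovers \<open>F\<close>. If the translate at
  \<open>inv k\<close> inverted \<open>x\<close>, so would \<open>F\<close> by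
  \<open>flipped_shift_gens\<close>, leaving only \<open>inv x = x\<close>.\<close>

lemma fixed_shift_inv_gens:
  assumes F: "pointed_isom F" and x: "x \<in> gens" and k: "k \<in> gens" and Fx: "F x = x"
  shows "shift F (inv k) x = x"
proof -
  have cl: "x \<in> carrier G" "k \<in> carrier G"
    using x k gens_closed by auto
  let ?H = "shift F (inv k)"
  have H: "pointed_isom ?H"
    using F cl pointed_isom_shift by auto
  have "shift ?H k x = x"
    using shift_shift[OF F, of "inv k" k x] shift_one[OF F] cl Fx by simp
  moreover have "?H x \<in> {x, inv x}"
    using pointed_isom_gens[OF H x] by (simp add: inv_class_def)
  ultimately show ?thesis
    using flipped_shift_gens[OF H x k] by auto
qed

lemma fixed_shift:
  assumes "pointed_isom F" "x \<in> gens" "F x = x" "a \<in> carrier G"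
  shows "shift F a x = x"
proof -
  have "a \<in> generate G gens"
    using assms(4) generate_gens by simp
  then show ?thesis
    using assms(1,3)
  \<comment> \<open>\<open>F\<close> is generalised because the translate at
    \<open>h1 \<otimes> h2\<close> is the translate at \<open>h1\<close> of the translate at
    \<open>h2\<close>.\<close>
  proof (induction arbitrary: F rule: generate.induct)
    case one
    then show ?case
      using shift_one gens_closed assms(2) by simp
  next
    case (incl h)
    then show ?case
      using fixed_shift_gens assms(2) by blast
  next
    case (inv h)
    then show ?case
      using fixed_shift_inv_gens assms(2) by blast
  next
    case (eng h1 h2)
    have h: "h1 \<in> carrier G" "h2 \<in> carrier G"
      using eng.hyps generate_gens by auto
    have "shift (shift F h2) h1 x = x"
      using eng.IH eng.prems pointed_isom_shift[OF _ h(2)] by blast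
    then show ?case
      using shift_shift eng.prems h gens_closed[OF assms(2)] by simp
  qed
qed

lemma fixed_mult:
  assumes "pointed_isom F" "x \<in> gens" "F x = x" "a \<in> carrier G"
  shows "F (x \<otimes> a) = x \<otimes> F a"
  using shift_mult[OF assms(1,4) gens_closed[OF assms(2)]] fixed_shift[OF assms] by simp

section \<open>All signs agree with that of the least non-involution\<close>

lemma not_mark_quotient:
  assumes s: "lead s" and x: "x \<in> gens" "s \<prec>\<^sub>r x"
  shows "\<not> mark (inv x \<otimes> s)"
proof
  assume "mark (inv x \<otimes> s)"
  then obtain s' y where y: "lead s'" "y \<in> gens" "s' \<prec>\<^sub>r y" "inv x \<otimes> s \<in> inv_class G (y \<otimes> s')"
    unfolding mark_def by blast
  have "s' = s"
    using s y(1) less_linear[of s s'] unfolding lead_def by blast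
  note y = y[unfolded this]
  have sg: "s \<in> gens" "s \<otimes> s \<noteq> \<one>"
    using s by (auto simp: lead_def)
  have cl: "x \<in> carrier G" "y \<in> carrier G" "s \<in> carrier G"
    using x y sg gens_closed by auto
  \<comment> \<open>Involutions come first, and \<open>x\<close> comes after the non-involution
    \<open>s\<close>.\<close>
  have xx: "x \<otimes> x \<noteq> \<one>"
    using involutions_first[OF cl(1,3)] sg x(2) less_asym by blast
  have eq: "inv x \<otimes> s = y \<otimes> s \<or> inv x \<otimes> s = inv y \<otimes> inv s"
    using y(4) cl by (auto simp: inv_class_def inv_mult)
  have mem: "inv x \<in> inv_class G x" "inv y \<in> inv_class G y" "inv s \<in> inv_class G s"
    by (auto simp: inv_class_def)
  \<comment> \<open>The larger generators of the two products must coincide. Cancelling them or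
    \<open>s\<close> then leaves \<open>inv x = x\<close> or \<open>s = inv s\<close>, both
    excluded.\<close>
  have "x = y"
    using eq
  proof
    assume "inv x \<otimes> s = y \<otimes> s"
    then show ?thesis
      by (rule product_top_eq[OF sg(1) x sg(1) y(2,3) inv_class_self mem(1) inv_class_self inv_class_self])
  next
    assume "inv x \<otimes> s = inv y \<otimes> inv s"
    then show ?thesis
      by (rule product_top_eq[OF sg(1) x sg(1) y(2,3) inv_class_self mem(1,3,2)])
  qed
  with eq have "inv x = x \<or> s = inv s"
    using cl by simp
  then show False
    using xx sg(2) r_inv[OF cl(1)] r_inv[OF cl(3)] by auto
qed

text \<open>If \<open>F\<close> inverted \<open>x\<close>, the quotient of \<open>x\<close> by
  \<open>inv s\<close> would change from \<open>x \<otimes> s\<close>, which is marked, to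
  \<open>inv x \<otimes> s\<close>, which is not.\<close>

lemma lead_fixed_imp_fixed:
  assumes F: "pointed_isom F" and s: "lead s" "F s = s" and x: "x \<in> gens"
  shows "F x = x"
proof (rule ccontr)
  assume neq: "F x \<noteq> x"
  then have Fx: "F x = inv x"
    using pointed_isom_gens[OF F x] by (simp add: inv_class_def)
  have sg: "s \<in> gens"
    using s by (simp add: lead_def)
  have cl: "x \<in> carrier G" "s \<in> carrier G"
    using x sg gens_closed by auto
  have "x \<otimes> x \<noteq> \<one>"
    using Fx neq cl inv_equality by metis
  then have "s \<prec>\<^sub>r x"
    using s x neq less_linear unfolding lead_def by metis
  \<comment> \<open>\<open>F\<close> commutes with multiplication by the fixed generator
    \<open>s\<close>, hence also fixes \<open>inv s\<close>, the point with which \<open>x\<close>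
    is compared.\<close>
  have "s \<otimes> F (inv s) = \<one>"
    using fixed_mult[OF F sg s(2), of "inv s"] pointed_isomD(2)[OF F] cl by simp
  then have "F (inv s) = inv s"
    using inv_unique'[of s "F (inv s)"] m_comm[of s "F (inv s)"] cl pointed_isomD(3)[OF F, of "inv s"] by simp
  then have "colour (inv x \<otimes> s) = colour (x \<otimes> s)"
    using pointed_isomD(4)[OF F, of x "inv s"] Fx cl by simp
  moreover have "mark (x \<otimes> s)"
    unfolding mark_def using s(1) x \<open>s \<prec>\<^sub>r x\<close> inv_class_self[of "x \<otimes> s" G] by blast
  ultimately show False
    using colour_eqD(4) not_mark_quotient[OF s(1) x \<open>s \<prec>\<^sub>r x\<close>] by blast
qed

lemma gens_fixed_imp_id:
  assumes F: "pointed_isom F" and fixed: "\<And>x. x \<in> gens \<Longrightarrow> F x = x" and g: "g \<in> carrier G"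
  shows "F g = g"
proof -
  \<comment> \<open>Commuting with multiplication by each generator passes to inverses and products,
    so it holds for all of \<open>G\<close>; \<open>a = \<one>\<close> then gives the claim.\<close>
  have "F (h \<otimes> a) = h \<otimes> F a" if "h \<in> generate G gens" "a \<in> carrier G" for h a
    using that
  proof (induction arbitrary: a rule: generate.induct)
    case one
    then show ?case
      using pointed_isomD(3)[OF F] by simp
  next
    case (incl h)
    then show ?case
      using fixed_mult[OF F] fixed by blast
  next
    case (inv h)
    have cl: "h \<in> carrier G" "F a \<in> carrier G" "F (inv h \<otimes> a) \<in> carrier G"
      using inv gens_closed pointed_isomD(3)[OF F] by auto
    have "h \<otimes> F (inv h \<otimes> a) = F (h \<otimes> (inv h \<otimes> a))"
      using fixed_mult[OF F inv(1) fixed[OF inv(1)], of "inv h \<otimes> a"] cl inv(2) by simp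
    also have "h \<otimes> (inv h \<otimes> a) = a"
      using cl inv(2) by (simp flip: m_assoc)
    finally show ?case
      using cl by (metis inv_solve_left)
  next
    case (eng h1 h2)
    then show ?case
      using generate_gens pointed_isomD(3)[OF F] by (simp add: m_assoc)
  qed
  from this[of g \<one>] show ?thesis
    using g generate_gens pointed_isomD(2)[OF F] by simp
qed

lemma pointed_isom_inv_class:
  assumes F: "pointed_isom F" and g: "g \<in> carrier G"
  shows "F g \<in> inv_class G g"
proof (cases "\<exists>s. lead s")
  case True
  then obtain s where s: "lead s" ..
  then have sg: "s \<in> gens"
    by (simp add: lead_def)
  consider "F s = s" | "inv (F s) = s"
    using pointed_isom_gens[OF F sg] gens_closed[OF sg] by (auto simp: inv_class_def)
  then show ?thesis
  proof cases
    case 1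
    then show ?thesis
      using gens_fixed_imp_id[OF F lead_fixed_imp_fixed[OF F s 1] g] by simp
  next
    case 2
    \<comment> \<open>\<open>F\<close> followed by inversion fixes \<open>s\<close>, hence is the
      identity.\<close>
    note F' = pointed_isom_inverse[OF F]
    have "inv (F g) = g"
      using gens_fixed_imp_id[OF F' lead_fixed_imp_fixed[OF F' s 2] g] by simp
    then have "F g = inv g"
      using pointed_isomD(3)[OF F g] by (metis inv_inv)
    then show ?thesis
      by (simp add: inv_class_def)
  qed
next
  case False
  \<comment> \<open>By well-foundedness, without a least generator of nontrivial square there is no
    such generator at all.\<close>
  have invol: "x \<otimes> x = \<one>" if "x \<in> gens" for x
    using that
  proof (induction x rule: wf_induct_rule[OF wf_r])
    case (1 x)
    then show ?case
      using False unfolding lead_def by blast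
  qed
  have "F x = x" if "x \<in> gens" for x
    using pointed_isom_gens[OF F that] inv_class_involution[OF gens_closed invol, OF that that] by simp
  then show ?thesis
    using gens_fixed_imp_id[OF F _ g] by simp
qed

section \<open>The metric and its isometry group\<close>

definition weight :: "bool \<times> bool \<times> bool \<times> bool \<times> bool \<Rightarrow> real" where
  "weight t = (if fst t then 0 else 1 + 1 / (1 + real (to_nat t)))"

text \<open>The default 0 off the carrier makes nonnegativity and symmetry hold for all arguments,
  as \<open>Metric_space\<close> demands.\<close>

definition metric :: "'a \<Rightarrow> 'a \<Rightarrow> real" where
  "metric x y = (if x \<in> carrier G \<and> y \<in> carrier G then weight (colour (x \<otimes> inv y)) else 0)"

lemma weight_bounds:
  shows "0 \<le> weight t" "weight t \<le> 2" "weight t = 0 \<longleftrightarrow> fst t" "\<not> fst t \<Longrightarrow> 1 \<le> weight t"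
proof -
  define w where "w = 1 / (1 + real (to_nat t))"
  have "0 < w" "w \<le> 1"
    by (simp_all add: w_def divide_simps)
  moreover have "weight t = (if fst t then 0 else 1 + w)"
    by (simp add: weight_def w_def)
  ultimately show "0 \<le> weight t" "weight t \<le> 2" "weight t = 0 \<longleftrightarrow> fst t" "\<not> fst t \<Longrightarrow> 1 \<le> weight t"
    by auto
qed

text \<open>\<open>weight\<close> collapses all tuples whose first flag is \<open>True\<close>, but
  only one of them is a colour, that of \<open>\<one>\<close>. On the others \<open>to_nat\<close>
  is injective.\<close>

lemma weight_colour_eqD:
  assumes "weight (colour g) = weight (colour h)"
  shows "colour g = colour h"
proof (cases "g = \<one> \<or> h = \<one>")
  case True
  then have "g = \<one> \<and> h = \<one>"
    using assms weight_bounds(3)[of "colour g"] weight_bounds(3)[of "colour h"]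
    by (simp add: colour_def)
  then show ?thesis
    by simp
next
  case False
  then have "real (to_nat (colour g)) = real (to_nat (colour h))"
    using assms by (simp add: weight_def) (simp add: colour_def)
  then show ?thesis
    by simp
qed

lemma metric_eq_0_iff:
  assumes "x \<in> carrier G" "y \<in> carrier G"
  shows "metric x y = 0 \<longleftrightarrow> x = y"
proof -
  have "x \<otimes> inv y = \<one> \<longleftrightarrow> x = y"
    using assms by (metis inv_closed inv_equality inv_inv r_inv)
  then show ?thesis
    using assms by (simp add: metric_def weight_bounds(3)) (simp add: colour_def)
qed

lemma metric_commute: "metric x y = metric y x"
  using colour_inv[of "x \<otimes> inv y"] by (auto simp: metric_def inv_mult_group)

lemma metric_nonneg: "0 \<le> metric x y"
  by (simp add: metric_def weight_bounds)

lemma metric_le_2: "metric x y \<le> 2"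
  by (simp add: metric_def weight_bounds)

lemma metric_ge_1:
  assumes "x \<in> carrier G" "y \<in> carrier G" "x \<noteq> y"
  shows "1 \<le> metric x y"
  using metric_eq_0_iff[OF assms(1,2)] assms weight_bounds(3,4)[of "colour (x \<otimes> inv y)"]
  by (simp add: metric_def)

lemma invariant_metric_metric: "invariant_metric G metric"
  unfolding invariant_metric_def
proof (intro conjI ballI)
  show "Metric_space (carrier G) metric"
  proof
    fix x y z assume *: "x \<in> carrier G" "y \<in> carrier G" "z \<in> carrier G"
    show "metric x z \<le> metric x y + metric y z"
    proof (cases "x = y \<or> y = z")
      case True
      then show ?thesis
        using metric_nonneg by auto
    next
      case False
      then show ?thesis
        using * metric_ge_1[of x y] metric_ge_1[of y z] metric_le_2[of x z] by simp
    qed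
  qed (rule metric_nonneg metric_commute metric_eq_0_iff; assumption?)+
  fix x y g assume "x \<in> carrier G" "y \<in> carrier G" "g \<in> carrier G"
  then show "metric (x \<otimes> g) (y \<otimes> g) = metric x y"
    using mult_inv_cancel_right[of x y "inv g"] by (simp add: metric_def)
qed

lemma Isom_metric: "Isom (carrier G) metric = Xi G"
proof (intro equalityI subsetI)
  fix F assume "F \<in> Isom (carrier G) metric"
  then have F: "F \<in> extensional (carrier G)" "F ` carrier G = carrier G"
    "\<And>x y. x \<in> carrier G \<Longrightarrow> y \<in> carrier G \<Longrightarrow> metric (F x) (F y) = metric x y"
    by (auto simp: Isom_def)
  then have closed: "F x \<in> carrier G" if "x \<in> carrier G" for x
    using that by blast
  have "inj_on F (carrier G)"
    using F(3) metric_eq_0_iff closed by (metis inj_onI)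
  then have "F \<in> Bij (carrier G)"
    using F by (simp add: Bij_def bij_betw_def)
  moreover have "inv_class G (F x \<otimes> inv (F y)) = inv_class G (x \<otimes> inv y)"
    if *: "x \<in> carrier G" "y \<in> carrier G" for x y
  proof -
    \<comment> \<open>Translating at \<open>y\<close> makes the isometry pointed; its value at
      \<open>x \<otimes> inv y\<close> is the quotient in question.\<close>
    have "pointed_isom (shift F y)"
    proof (intro pointed_isom_shiftI weight_colour_eqD)
      fix u v assume "u \<in> carrier G" "v \<in> carrier G"
      then show "weight (colour (F u \<otimes> inv (F v))) = weight (colour (u \<otimes> inv v))"
        using F(3)[of u v] closed by (simp add: metric_def)
    qed (use F(2) * in auto)
    then have "shift F y (x \<otimes> inv y) \<in> inv_class G (x \<otimes> inv y)"
      using * by (intro pointed_isom_inv_class) auto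
    moreover have "shift F y (x \<otimes> inv y) = F x \<otimes> inv (F y)"
      using * by (simp add: shift_def m_assoc)
    ultimately show ?thesis
      using * by (intro inv_class_eq) auto
  qed
  ultimately show "F \<in> Xi G"
    by (simp add: Xi_def)
next
  fix F assume "F \<in> Xi G"
  then have F: "F \<in> extensional (carrier G)" "F ` carrier G = carrier G"
    "\<And>x y. x \<in> carrier G \<Longrightarrow> y \<in> carrier G \<Longrightarrow>
      inv_class G (F x \<otimes> inv (F y)) = inv_class G (x \<otimes> inv y)"
    by (auto simp: Xi_def Bij_def bij_betw_def)
  have "metric (F x) (F y) = metric x y" if "x \<in> carrier G" "y \<in> carrier G" for x y
  proof -
    have "F x \<otimes> inv (F y) \<in> inv_class G (x \<otimes> inv y)"
      using F(3)[OF that] inv_class_self[of "F x \<otimes> inv (F y)" G] by simp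
    then have "colour (F x \<otimes> inv (F y)) = colour (x \<otimes> inv y)"
      using that colour_inv[of "x \<otimes> inv y"] by (auto simp: inv_class_def)
    moreover have "F x \<in> carrier G" "F y \<in> carrier G"
      using F(2) that by auto
    ultimately show ?thesis
      using that by (simp add: metric_def)
  qed
  then show "F \<in> Isom (carrier G) metric"
    using F by (simp add: Isom_def)
qed

section \<open>Counting the values\<close>

lemma metric_values_bound:
  assumes "\<And>g. g \<in> carrier G \<Longrightarrow> g \<noteq> \<one> \<Longrightarrow> colour g \<in> T" "finite T"
  shows "finite (metric_values (carrier G) metric)"
    and "card (metric_values (carrier G) metric) \<le> Suc (card T)"
proof -
  have "metric x y \<in> insert 0 (weight ` T)" if "x \<in> carrier G" "y \<in> carrier G" for x y
    using assms(1)[of "x \<otimes> inv y"] that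
    by (cases "x \<otimes> inv y = \<one>") (auto simp: metric_def weight_def colour_def)
  then have sub: "metric_values (carrier G) metric \<subseteq> insert 0 (weight ` T)"
    by (auto simp: metric_values_def)
  have fin: "finite (insert 0 (weight ` T))"
    using assms(2) by simp
  show "finite (metric_values (carrier G) metric)"
    using finite_subset[OF sub fin] .
  have "card (metric_values (carrier G) metric) \<le> card (insert 0 (weight ` T))"
    using card_mono[OF fin sub] .
  also have "\<dots> \<le> Suc (card T)"
    using card_image_le[OF assms(2), of weight] assms(2) by (simp add: card_insert_if)
  finally show "card (metric_values (carrier G) metric) \<le> Suc (card T)" .
qed

lemma card_metric_values:
  "finite (metric_values (carrier G) metric)" "card (metric_values (carrier G) metric) \<le> 17"
proof -
  let ?T = "{False} \<times> (UNIV :: (bool \<times> bool \<times> bool \<times> bool) set)"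
  have "colour g \<in> ?T" if "g \<noteq> \<one>" for g
    using that by (simp add: colour_def)
  note bound = metric_values_bound[of ?T, OF this]
  show "finite (metric_values (carrier G) metric)"
    by (rule bound) auto
  have "card ?T = 16"
    by (simp add: card_UNIV_bool flip: UNIV_Times_UNIV)
  then show "card (metric_values (carrier G) metric) \<le> 17"
    using bound(2) by simp
qed

text \<open>Nothing is marked as there are no non-involutions, and the two node flags and the edge
  flag exclude one another. This leaves four nonzero values.\<close>

lemma card_metric_values_boolean:
  assumes boolean: "\<And>x. x \<in> carrier G \<Longrightarrow> x \<otimes> x = \<one>"
  shows "card (metric_values (carrier G) metric) \<le> 5"
proof -
  let ?T = "{(False, True, False, False, False), (False, False, True, False, False),
    (False, False, False, True, False), (False, False, False, False, False)}"
  have unmarked: "\<not> mark g" for g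
    using boolean gens_closed by (auto simp: mark_def lead_def)
  have inv_class_gens: "h = x" if "x \<in> gens" "h \<in> inv_class G x" for x h
    using that inv_class_involution gens_closed boolean by blast
  \<comment> \<open>A product \<open>y \<otimes> x\<close> of generators with \<open>x\<close>
    before \<open>y\<close> is no generator \<open>g\<close>: \<open>y\<close> before
    \<open>g\<close> puts \<open>g\<close> into \<open>lower g\<close>, \<open>g\<close> before
    \<open>y\<close> puts \<open>y\<close> into \<open>lower y\<close>, and \<open>g = y\<close>
    forces \<open>x = \<one>\<close>.\<close>
  have edge_not_node: "\<not> node p g" if "edge g" for p g
  proof
    assume "node p g"
    then have g: "g \<in> gens"
      using inv_class_gens unfolding node_def by blast
    obtain x y where xy: "x \<in> gens" "y \<in> gens" "x \<prec>\<^sub>r y" "g = y \<otimes> x"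
      using \<open>edge g\<close> inv_class_gens unfolding edge_def by metis
    have cl: "x \<in> carrier G" "y \<in> carrier G" "g \<in> carrier G"
      using xy g gens_closed by auto
    have "\<not> y \<prec>\<^sub>r g"
      using xy g cl subgroup.one_closed[OF subgroup_lower]
      by (intro product_top_unique[of x y \<one> g x y g]) auto
    moreover have "\<not> g \<prec>\<^sub>r y"
    proof
      assume "g \<prec>\<^sub>r y"
      then have "g \<otimes> inv x \<in> lower y"
        using xy cl lower_memI subgroup_lower inv_class_self
        by (metis subgroup.m_closed subgroup.m_inv_closed)
      moreover have "g \<otimes> inv x = y"
        using xy cl by (simp add: m_assoc)
      ultimately show False
        using xy by (simp add: gens_def)
    qed
    ultimately have "y \<otimes> x = y"
      using less_linear xy by blast
    then show False
      using cl one_notin_gens xy by simp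
  qed
  have "colour g \<in> ?T" if "g \<noteq> \<one>" for g
    using that unmarked[of g] edge_not_node[of g] node_unique[of False g True]
    by (cases "edge g") (auto simp: colour_def)
  then have "card (metric_values (carrier G) metric) \<le> Suc (card ?T)"
    by (intro metric_values_bound) auto
  also have "\<dots> \<le> 5"
    by simp
  finally show ?thesis .
qed

end

section \<open>Existence of the order and colouring; Boolean groups\<close>

lemma (in comm_group) coloured_comm_group_exists:
  obtains r par where "coloured_comm_group G r par"
proof -
  obtain r0 where "well_order_on (UNIV :: 'a set) r0"
    using well_order_on by blast
  then have r0: "wf (r0 - Id)" "trans (r0 - Id)" "total (r0 - Id)"
    unfolding well_order_on_def linear_order_on_def partial_order_on_def preorder_on_def
    by (auto intro: trans_diff_Id)
  \<comment> \<open>The key is 0 exactly when the square is \<open>\<one>\<close>, so the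
    lexicographic order puts involutions first; removing \<open>Id\<close> makes the well-order
    strict.\<close>
  define r where "r = inv_image (less_than <*lex*> (r0 - Id)) (\<lambda>x. (of_bool (x \<otimes> x \<noteq> \<one>) :: nat, x))"
  have r: "wf r" "trans r" "total r"
    using r0 unfolding r_def
    by (auto intro!: wf_inv_image wf_lex_prod trans_inv_image trans_lex_prod trans_less_than)
      (auto simp: total_on_def inv_image_def)
  interpret ordered_comm_group G r
    by unfold_locales (use r in \<open>auto simp: r_def inv_image_def\<close>)
  show thesis
  proof (rule wf_alternating_colouring[OF r, where X = gens])
    fix par :: "'a \<Rightarrow> bool"
    assume "\<And>x y. x \<in> gens \<Longrightarrow> y \<in> gens \<Longrightarrow> (x, y) \<in> r \<Longrightarrow> par x = par y \<Longrightarrow>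
       \<exists>z\<in>gens. (x, z) \<in> r \<and> (z, y) \<in> r \<and> par z \<noteq> par x"
    then have "coloured_comm_group G r par"
      by unfold_locales
    then show thesis ..
  qed
qed

lemma boolean_group_square:
  assumes "boolean_group G" "x \<in> carrier G"
  shows "x \<otimes>\<^bsub>G\<^esub> x = \<one>\<^bsub>G\<^esub>"
proof -
  interpret group G
    using assms by (simp add: boolean_group_def)
  have "1 \<le> ord x" "ord x \<le> 2"
    using assms unfolding boolean_group_def by auto
  then have "ord x = 1 \<or> ord x = 2"
    by linarith
  then have "ord x dvd 2"
    by auto
  then have "x [^]\<^bsub>G\<^esub> (2::nat) = \<one>\<^bsub>G\<^esub>"
    using assms(2) pow_eq_id by blast
  then show ?thesis
    using assms(2) by (simp add: numeral_2_eq_2)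
qed

text \<open>Every element is its own inverse, and inverting \<open>x \<otimes> y\<close> swaps the
  factors.\<close>

lemma boolean_group_comm:
  assumes "boolean_group G"
  shows "comm_group G"
proof -
  interpret group G
    using assms by (simp add: boolean_group_def)
  have inv: "inv\<^bsub>G\<^esub> x = x" if "x \<in> carrier G" for x
    using that boolean_group_square[OF assms] inv_equality by blast
  show ?thesis
  proof (rule group_comm_groupI)
    fix x y assume "x \<in> carrier G" "y \<in> carrier G"
    then show "x \<otimes>\<^bsub>G\<^esub> y = y \<otimes>\<^bsub>G\<^esub> x"
      using inv_mult_group[of x y] by (simp add: inv)
  qed
qed

theorem proposition6p6:
  shows "(\<forall>G :: ('a, 'm) monoid_scheme. comm_group G \<longrightarrow>
            (\<exists>d. invariant_metric G d \<and> Isom (carrier G) d = Xi G \<and>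
                 finite (metric_values (carrier G) d) \<and>
                 card (metric_values (carrier G) d) \<le> 17)) \<and>
         (\<forall>G :: ('b, 'n) monoid_scheme. boolean_group G \<longrightarrow>
            (\<exists>d. invariant_metric G d \<and> Isom (carrier G) d = Xi G \<and>
                 finite (metric_values (carrier G) d) \<and>
                 card (metric_values (carrier G) d) \<le> 5))"
proof (intro conjI allI impI)
  fix G :: "('a, 'm) monoid_scheme"
  assume "comm_group G"
  then obtain r par where "coloured_comm_group G r par"
    using comm_group.coloured_comm_group_exists by blast
  then interpret coloured_comm_group G r par .
  show "\<exists>d. invariant_metric G d \<and> Isom (carrier G) d = Xi G \<and>
      finite (metric_values (carrier G) d) \<and> card (metric_values (carrier G) d) \<le> 17"
    using invariant_metric_metric Isom_metric card_metric_values by blast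
next
  fix G :: "('b, 'n) monoid_scheme"
  assume boolean: "boolean_group G"
  then obtain r par where "coloured_comm_group G r par"
    using comm_group.coloured_comm_group_exists boolean_group_comm by blast
  then interpret coloured_comm_group G r par .
  show "\<exists>d. invariant_metric G d \<and> Isom (carrier G) d = Xi G \<and>
      finite (metric_values (carrier G) d) \<and> card (metric_values (carrier G) d) \<le> 5"
    using invariant_metric_metric Isom_metric card_metric_values(1)
      card_metric_values_boolean boolean_group_square[OF boolean] by blast
qed

end
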